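(* Consider a $k$-CS-PIP instance normalized so that $c_j=1$ and $s_{ij}\le1$ for all $i,j$, and let $\alpha>0$ with $\alpha k\ge1$. Let $x$ be an optimal solution of the strengthened LP: $\max\sum_i w_ix_i$ subject to $\sum_i s_{ij}x_i\le1$ for all $j$, $\sum_{i\in B(j)}x_i\le1$ for all $j$, $0\le x_i\le1$ for all $i$, where $B(j)=\{i: s_{ij}>1/2\}$. Let $\mathcal{S}$ contain each item $i$ independently with probability $x_i/(\alpha k)$. For an item $i$ and a constraint $j$ with $s_{ij}>0$, let $E_{ij}$ be the event that the items $\{i'\in\mathcal{S}\mid s_{i'j}\ge s_{ij}\}$ have total size $\sum s_{i'j}$ exceeding $1$; let $\mathcal{S}'$ be the set of $i\in\mathcal{S}$ for which no $E_{ij}$ (over $j$ with $s_{ij}>0$) occurs. Then for each item $i$ (with $x_i>0$), $\Pr[i\in\mathcal{S}'\mid i\in\mathcal{S}]\ge\left(1-\frac{1}{\alpha k}\left(1+\left(\frac{2}{\alpha k}\right)^{1/3}\right)\right)^k$.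
   Context: $k$-CS-PIP: maximize $w^Tx$ subject to $Sx\le c$, $x\in\{0,1\}^n$, with $w\in\mathbb{R}^n_+$, $c\in\mathbb{R}^m_+$, $S=(s_{ij})\in\mathbb{R}_+^{m\times n}$ having at most $k$ nonzero entries per column.
   Formalization: The base of the k-th power is replaced by its maximum with 0: for 1 ≤ αk < 2 it is negative, and for even k the literal bound can exceed 1 (k=2, α=1/2, one item with s=w=x=1 gives 2^(2/3)); for αk ≥ 2 the bound is unchanged. *)

theory Defs
  imports "HOL-Probability.Probability"
begin

text \<open>
  Items are indexed by a finite set \<open>I\<close> and constraints by a finite set \<open>J\<close>; \<open>s i j\<close> is the size
  of item \<open>i\<close> in constraint \<open>j\<close>. The column of the constraint matrix belonging to item \<open>i\<close> is
  thus \<open>s i\<close>, restricted to \<open>J\<close>.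
\<close>

definition kcs_pip ::
  "nat \<Rightarrow> 'i set \<Rightarrow> 'j set \<Rightarrow> ('i \<Rightarrow> real) \<Rightarrow> ('i \<Rightarrow> 'j \<Rightarrow> real) \<Rightarrow> ('j \<Rightarrow> real) \<Rightarrow> bool" where
  "kcs_pip k I J w s c \<longleftrightarrow>
     finite I \<and> finite J \<and>
     (\<forall>i\<in>I. 0 \<le> w i) \<and> (\<forall>j\<in>J. 0 \<le> c j) \<and> (\<forall>i\<in>I. \<forall>j\<in>J. 0 \<le> s i j) \<and>
     (\<forall>i\<in>I. card {j \<in> J. s i j \<noteq> 0} \<le> k)"

definition big_items :: "'i set \<Rightarrow> ('i \<Rightarrow> 'j \<Rightarrow> real) \<Rightarrow> 'j \<Rightarrow> 'i set" where
  "big_items I s j = {i \<in> I. s i j > 1 / 2}"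

definition strong_lp_feasible ::
  "'i set \<Rightarrow> 'j set \<Rightarrow> ('i \<Rightarrow> 'j \<Rightarrow> real) \<Rightarrow> ('i \<Rightarrow> real) \<Rightarrow> bool" where
  "strong_lp_feasible I J s x \<longleftrightarrow>
     (\<forall>j\<in>J. (\<Sum>i\<in>I. s i j * x i) \<le> 1) \<and>
     (\<forall>j\<in>J. (\<Sum>i\<in>big_items I s j. x i) \<le> 1) \<and>
     (\<forall>i\<in>I. 0 \<le> x i \<and> x i \<le> 1)"

definition strong_lp_optimal ::
  "'i set \<Rightarrow> 'j set \<Rightarrow> ('i \<Rightarrow> real) \<Rightarrow> ('i \<Rightarrow> 'j \<Rightarrow> real) \<Rightarrow> ('i \<Rightarrow> real) \<Rightarrow> bool" where
  "strong_lp_optimal I J w s x \<longleftrightarrow>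
     strong_lp_feasible I J s x \<and>
     (\<forall>y. strong_lp_feasible I J s y \<longrightarrow> (\<Sum>i\<in>I. w i * y i) \<le> (\<Sum>i\<in>I. w i * x i))"

definition independent_sample :: "'i set \<Rightarrow> ('i \<Rightarrow> real) \<Rightarrow> 'i set pmf" where
  "independent_sample I p =
     map_pmf (\<lambda>f. {i \<in> I. f i}) (Pi_pmf I False (\<lambda>i. bernoulli_pmf (p i)))"

text \<open>The event \<open>E i j\<close>, as a predicate of the sampled set \<open>R\<close>.\<close>

definition overflow :: "('i \<Rightarrow> 'j \<Rightarrow> real) \<Rightarrow> 'i \<Rightarrow> 'j \<Rightarrow> 'i set \<Rightarrow> bool" where
  "overflow s i j R \<longleftrightarrow> (\<Sum>i'\<in>{i' \<in> R. s i' j \<ge> s i j}. s i' j) > 1"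

definition altered :: "'j set \<Rightarrow> ('i \<Rightarrow> 'j \<Rightarrow> real) \<Rightarrow> 'i set \<Rightarrow> 'i set" where
  "altered J s R = {i \<in> R. \<forall>j\<in>J. s i j > 0 \<longrightarrow> \<not> overflow s i j R}"

end

theory Submission
  imports Defs
begin

text \<open>
  Write \<open>\<beta> = \<alpha> k\<close> and \<open>t = (2 / \<beta>)\<^bsup>1/3\<^esup>\<close>, and fix an item \<open>i\<close> of size \<open>\<sigma> = s i j\<close>. Conditioned on
  \<open>i\<close> being sampled, each event \<open>E i j\<close> has probability at most \<open>(1 + t) / \<beta>\<close>. If \<open>\<sigma> > 1/2\<close>, the
  event needs another big item, which the strengthened LP makes unlikely (\<open>1 / \<beta>\<close>). If
  \<open>\<sigma> \<le> 1/2\<close> and \<open>2 \<sigma> \<le> t\<close>, Markov's inequality gives \<open>1 / (\<beta> (1 - \<sigma>)) \<le> (1 + 2 \<sigma>) / \<beta>\<close>. If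
  \<open>\<sigma> \<le> 1/2\<close> and \<open>t \<le> 2 \<sigma>\<close>, the event needs a big item or two further items of size in
  \<open>[\<sigma>, 1/2]\<close>; the latter have total LP weight at most \<open>1 / \<sigma>\<close>, so the pair has probability at most
  \<open>1 / (2 \<sigma>\<^sup>2 \<beta>\<^sup>2) \<le> t / \<beta>\<close>. The complements of the events \<open>E i j\<close> are decreasing in the sample, so
  by Harris' inequality the probability that none of them occurs is at least the product of the
  individual probabilities, which has at most \<open>k\<close> factors.
\<close>

section \<open>Expectations under independent sampling\<close>

lemma set_pmf_independent_sample: "set_pmf (independent_sample I p) \<subseteq> Pow I"
  by (auto simp: independent_sample_def)

lemma integrable_independent_sample [simp]:
  fixes f :: "'i set \<Rightarrow> real"
  assumes "finite I"
  shows "integrable (measure_pmf (independent_sample I p)) f"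
  using assms set_pmf_independent_sample[of I p]
  by (intro integrable_measure_pmf_finite) (auto intro: finite_subset)

lemma expectation_independent_sample_mono:
  fixes f g :: "'i set \<Rightarrow> real"
  assumes "finite I" and "\<And>R. R \<subseteq> I \<Longrightarrow> f R \<le> g R"
  shows "measure_pmf.expectation (independent_sample I p) f
    \<le> measure_pmf.expectation (independent_sample I p) g"
  using assms set_pmf_independent_sample[of I p]
  by (intro integral_mono_AE) (auto simp: AE_measure_pmf_iff)

text \<open>The coin of \<open>a\<close> is tossed first and the rest is an independent sample of
  \<open>I\<close>. Revealing one coin at a time in this way underlies all the computations that
  follow.\<close>

lemma independent_sample_insert:
  assumes "finite I" and "a \<notin> I"
  shows "independent_sample (insert a I) p =
    bind_pmf (bernoulli_pmf (p a))
      (\<lambda>b. map_pmf (\<lambda>R. if b then insert a R else R) (independent_sample I p))"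
proof -
  have eq: "{i \<in> insert a I. (f(a := b)) i} =
      (if b then insert a {i \<in> I. f i} else {i \<in> I. f i})" for f b
    using assms by auto
  show ?thesis
    unfolding independent_sample_def
    using assms
    by (simp add: Pi_pmf_insert' map_bind_pmf map_pmf_comp map_pmf_def[symmetric] eq
        del: fun_upd_apply insert_iff)
qed

lemma expectation_independent_sample_insert:
  fixes f :: "'i set \<Rightarrow> real"
  assumes "finite I" and "a \<notin> I" and "p a \<in> {0..1}"
  shows "measure_pmf.expectation (independent_sample (insert a I) p) f =
    p a * measure_pmf.expectation (independent_sample I p) (\<lambda>R. f (insert a R)) +
    (1 - p a) * measure_pmf.expectation (independent_sample I p) f"
proof -
  have fin: "finite (set_pmf (independent_sample I p))"
    using assms(1) set_pmf_independent_sample[of I p] by (auto intro: finite_subset)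
  show ?thesis
    unfolding independent_sample_insert[OF assms(1,2)]
    using assms(3) fin
    by (subst pmf_expectation_bind[where A = UNIV]) (auto simp: UNIV_bool)
qed

lemma expectation_independent_sample_remove:
  fixes f :: "'i set \<Rightarrow> real"
  assumes "finite I" and "a \<in> I" and "p a \<in> {0..1}"
  shows "measure_pmf.expectation (independent_sample I p) f =
    p a * measure_pmf.expectation (independent_sample (I - {a}) p) (\<lambda>R. f (insert a R)) +
    (1 - p a) * measure_pmf.expectation (independent_sample (I - {a}) p) f"
  using expectation_independent_sample_insert[of "I - {a}" a p f] assms
  by (simp add: insert_absorb)

section \<open>Membership probabilities of one item and of two distinct items\<close>

lemma expectation_independent_sample_notin:
  assumes "finite I" and "a \<notin> I"
  shows "measure_pmf.expectation (independent_sample I p) (\<lambda>R. of_bool (a \<in> R \<and> P R)) = (0::real)"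
  using assms set_pmf_independent_sample[of I p]
  by (intro integral_eq_zero_AE) (auto simp: AE_measure_pmf_iff)

lemma expectation_independent_sample_mem:
  assumes "finite I" and "a \<in> I" and "p a \<in> {0..1}"
  shows "measure_pmf.expectation (independent_sample I p) (\<lambda>R. of_bool (a \<in> R)) = p a"
  using expectation_independent_sample_notin[of "I - {a}" a p "\<lambda>_. True"] assms
  by (subst expectation_independent_sample_remove[where p = p, OF assms]) simp

lemma expectation_independent_sample_mem_pair:
  assumes "finite I" and "a \<in> I" and "b \<in> I" and "a \<noteq> b"
    and "p a \<in> {0..1}" and "p b \<in> {0..1}"
  shows "measure_pmf.expectation (independent_sample I p) (\<lambda>R. of_bool (a \<in> R \<and> b \<in> R))
    = p a * p b"
  using expectation_independent_sample_notin[of "I - {a}" a p "\<lambda>R. b \<in> R"]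
    expectation_independent_sample_mem[of "I - {a}" b p] assms
  by (subst expectation_independent_sample_remove[where p = p, OF assms(1,2,5)]) simp

section \<open>Harris' inequality\<close>

text \<open>The right side minus the left side is
  \<open>q * (1 - q) * (f0 - f1) * (g0 - g1)\<close>. This is Harris' inequality for a single
  coin.\<close>

lemma two_point_Chebyshev:
  fixes q f0 f1 g0 g1 :: real
  assumes "q \<in> {0..1}" and "f1 \<le> f0" and "g1 \<le> g0"
  shows "(q * f1 + (1 - q) * f0) * (q * g1 + (1 - q) * g0) \<le> q * (f1 * g1) + (1 - q) * (f0 * g0)"
proof -
  have "0 \<le> (q * (1 - q)) * ((f0 - f1) * (g0 - g1))"
    using assms by simp
  then show ?thesis
    by (simp add: algebra_simps)
qed

text \<open>Induction on the items. With the coin of \<open>a\<close> fixed, \<open>f\<close> and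
  \<open>g\<close> are still decreasing in the remaining coins, so the induction hypothesis applies
  to both outcomes. The two conditional means are ordered as well, and the single-coin case combines
  them.\<close>

lemma Harris_inequality_antimono:
  fixes f g :: "'i set \<Rightarrow> real"
  assumes "finite I" and "\<And>a. a \<in> I \<Longrightarrow> p a \<in> {0..1}"
    and "\<And>R R'. R \<subseteq> R' \<Longrightarrow> R' \<subseteq> I \<Longrightarrow> f R' \<le> f R"
    and "\<And>R R'. R \<subseteq> R' \<Longrightarrow> R' \<subseteq> I \<Longrightarrow> g R' \<le> g R"
  shows "measure_pmf.expectation (independent_sample I p) f *
      measure_pmf.expectation (independent_sample I p) g
    \<le> measure_pmf.expectation (independent_sample I p) (\<lambda>R. f R * g R)"
  using assms
proof (induction I arbitrary: f g rule: finite_induct)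
  case empty
  then show ?case
    by (simp add: independent_sample_def)
next
  case (insert a I)
  define E where "E h = measure_pmf.expectation (independent_sample I p) h" for h :: "'i set \<Rightarrow> real"
  let ?f1 = "\<lambda>R. f (insert a R)" and ?g1 = "\<lambda>R. g (insert a R)"
  have q: "p a \<in> {0..1}"
    using insert.prems(1) by blast
  note expand = expectation_independent_sample_insert[where p = p, OF insert.hyps q, folded E_def]
  have IH1: "E ?f1 * E ?g1 \<le> E (\<lambda>R. ?f1 R * ?g1 R)"
    unfolding E_def
    by (rule insert.IH; use insert.prems in \<open>simp add: insert_mono subset_insertI2\<close>)
  have IH0: "E f * E g \<le> E (\<lambda>R. f R * g R)"
    unfolding E_def
    by (rule insert.IH; use insert.prems in \<open>simp add: subset_insertI2\<close>)
  have "f (insert a R) \<le> f R" and "g (insert a R) \<le> g R" if "R \<subseteq> I" for R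
    using that by (auto intro!: insert.prems(2,3))
  then have "E ?f1 \<le> E f" and "E ?g1 \<le> E g"
    unfolding E_def by (simp_all add: expectation_independent_sample_mono insert.hyps(1))
  then have "(p a * E ?f1 + (1 - p a) * E f) * (p a * E ?g1 + (1 - p a) * E g)
      \<le> p a * (E ?f1 * E ?g1) + (1 - p a) * (E f * E g)"
    by (intro two_point_Chebyshev q)
  also have "\<dots> \<le> p a * E (\<lambda>R. ?f1 R * ?g1 R) + (1 - p a) * E (\<lambda>R. f R * g R)"
    using q IH0 IH1 by (intro add_mono mult_left_mono) auto
  finally show ?case
    unfolding expand .
qed

lemma Harris_inequality_prod_antimono:
  fixes f :: "'j \<Rightarrow> 'i set \<Rightarrow> real"
  assumes "finite I" and "\<And>a. a \<in> I \<Longrightarrow> p a \<in> {0..1}" and "finite K"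
    and "\<And>j R R'. j \<in> K \<Longrightarrow> R \<subseteq> R' \<Longrightarrow> R' \<subseteq> I \<Longrightarrow> f j R' \<le> f j R"
    and "\<And>j R. j \<in> K \<Longrightarrow> 0 \<le> f j R"
  shows "(\<Prod>j\<in>K. measure_pmf.expectation (independent_sample I p) (f j))
    \<le> measure_pmf.expectation (independent_sample I p) (\<lambda>R. \<Prod>j\<in>K. f j R)"
  using assms(3,4,5)
proof (induction K rule: finite_induct)
  case empty
  then show ?case by simp
next
  case (insert j K)
  let ?E = "measure_pmf.expectation (independent_sample I p)"
  have "?E (f j) * (\<Prod>j\<in>K. ?E (f j)) \<le> ?E (f j) * ?E (\<lambda>R. \<Prod>j\<in>K. f j R)"
    using insert.prems by (intro mult_left_mono insert.IH Bochner_Integration.integral_nonneg) auto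
  \<comment> \<open>The partial product is itself decreasing because its factors are decreasing and
    nonnegative, so the version for two functions applies.\<close>
  also have "\<dots> \<le> ?E (\<lambda>R. f j R * (\<Prod>j\<in>K. f j R))"
    using insert.prems
    by (intro Harris_inequality_antimono assms(1,2)) (auto intro!: prod_mono)
  finally show ?case
    using insert.hyps by simp
qed

section \<open>The probability of an overflow\<close>

lemma overflow_mono:
  assumes "overflow s i j R" and "R \<subseteq> R'" and "finite R'" and "\<And>a. a \<in> R' \<Longrightarrow> 0 \<le> s a j"
  shows "overflow s i j R'"
  using assms unfolding overflow_def
  by (elim order.strict_trans2, intro sum_mono2) auto

text \<open>Item \<open>i\<close> always counts towards its own overflow. Moving its size to the
  right leaves a condition on the other sampled items alone.\<close>

lemma overflow_insert_iff:
  assumes "finite R" and "i \<notin> R"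
  shows "overflow s i j (insert i R) \<longleftrightarrow> (\<Sum>a\<in>{a \<in> R. s i j \<le> s a j}. s a j) > 1 - s i j"
proof -
  have "{a \<in> insert i R. s i j \<le> s a j} = insert i {a \<in> R. s i j \<le> s a j}"
    by auto
  then show ?thesis
    using assms by (auto simp: overflow_def)
qed

section \<open>Expected weighted counts of sampled items and pairs\<close>

lemma expectation_weighted_count:
  fixes v :: "'i \<Rightarrow> real"
  assumes "finite I" and "\<And>a. a \<in> I \<Longrightarrow> p a \<in> {0..1}" and "A \<subseteq> I"
  shows "measure_pmf.expectation (independent_sample I p) (\<lambda>R. \<Sum>a\<in>A. v a * of_bool (a \<in> R))
    = (\<Sum>a\<in>A. v a * p a)"
  using assms expectation_independent_sample_mem[of I _ p]
  by (subst Bochner_Integration.integral_sum) (auto intro!: sum.cong)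

lemma expectation_ordered_pairs_le:
  assumes "finite I" and "\<And>a. a \<in> I \<Longrightarrow> p a \<in> {0..1}" and "A \<subseteq> I"
  shows "measure_pmf.expectation (independent_sample I p)
      (\<lambda>R. \<Sum>a\<in>A. \<Sum>b\<in>A - {a}. of_bool (a \<in> R \<and> b \<in> R)) \<le> (\<Sum>a\<in>A. p a)\<^sup>2"
proof -
  have fin: "finite A"
    using assms finite_subset by blast
  have "measure_pmf.expectation (independent_sample I p)
      (\<lambda>R. \<Sum>a\<in>A. \<Sum>b\<in>A - {a}. of_bool (a \<in> R \<and> b \<in> R)) =
      (\<Sum>a\<in>A. \<Sum>b\<in>A - {a}. measure_pmf.expectation (independent_sample I p)
        (\<lambda>R. of_bool (a \<in> R \<and> b \<in> R)) :: real)"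
    using assms(1)
    by (simp add: Bochner_Integration.integral_sum del: of_bool_conj)
  also have "\<dots> = (\<Sum>a\<in>A. \<Sum>b\<in>A - {a}. p a * p b)"
    using assms by (intro sum.cong expectation_independent_sample_mem_pair refl) auto
  \<comment> \<open>Adding the diagonal terms \<open>p a * p a\<close> completes the square.\<close>
  also have "\<dots> \<le> (\<Sum>a\<in>A. \<Sum>b\<in>A. p a * p b)"
    using assms fin by (intro sum_mono sum_mono2) (auto intro!: mult_nonneg_nonneg dest!: subsetD)
  also have "\<dots> = (\<Sum>a\<in>A. p a)\<^sup>2"
    by (simp add: power2_eq_square sum_product)
  finally show ?thesis .
qed

text \<open>Item \<open>i\<close> alone fits, so an overflow requires another sampled item at least
  as large, hence a big one. A union bound over the big items finishes.\<close>

lemma expectation_overflow_le_big: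
  assumes "finite I" and "\<And>a. a \<in> I \<Longrightarrow> p a \<in> {0..1}" and "i \<notin> I"
    and "1 / 2 < s i j" and "s i j \<le> 1"
  shows "measure_pmf.expectation (independent_sample I p)
      (\<lambda>R. of_bool (overflow s i j (insert i R))) \<le> (\<Sum>a\<in>big_items I s j. p a)"
proof -
  let ?B = "big_items I s j"
  have finB: "finite ?B" and BI: "?B \<subseteq> I"
    using assms(1) by (auto simp: big_items_def)
  have "of_bool (overflow s i j (insert i R)) \<le> (\<Sum>a\<in>?B. 1 * of_bool (a \<in> R) :: real)"
    if R: "R \<subseteq> I" for R
  proof (cases "overflow s i j (insert i R)")
    case True
    have "finite R" "i \<notin> R"
      using R assms finite_subset by blast+
    then have "(\<Sum>a\<in>{a \<in> R. s i j \<le> s a j}. s a j) > 0"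
      using True assms(5) by (simp add: overflow_insert_iff)
    then have "{a \<in> R. s i j \<le> s a j} \<noteq> {}"
      by force
    then obtain a where "a \<in> R" "s i j \<le> s a j"
      by blast
    then have "a \<in> ?B" "a \<in> R"
      using R assms(4) by (auto simp: big_items_def)
    then have "(1::real) \<le> (\<Sum>a\<in>?B. of_bool (a \<in> R))"
      using finB member_le_sum[of a ?B "\<lambda>a. of_bool (a \<in> R) :: real"] by simp
    then show ?thesis by simp
  qed (simp add: sum_nonneg)
  then have "measure_pmf.expectation (independent_sample I p)
      (\<lambda>R. of_bool (overflow s i j (insert i R)))
      \<le> measure_pmf.expectation (independent_sample I p) (\<lambda>R. \<Sum>a\<in>?B. 1 * of_bool (a \<in> R) :: real)"
    by (rule expectation_independent_sample_mono[OF assms(1)])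
  also have "\<dots> = (\<Sum>a\<in>?B. 1 * p a)"
    by (rule expectation_weighted_count[where p = p, OF assms(1,2) BI])
  finally show ?thesis by simp
qed

text \<open>Markov's inequality for the total size of the other sampled items, with threshold
  \<open>1 - s i j\<close>. It is kept in product form to avoid a division.\<close>

lemma expectation_overflow_le_Markov:
  assumes "finite I" and "\<And>a. a \<in> I \<Longrightarrow> p a \<in> {0..1}" and "i \<notin> I"
    and "\<And>a. a \<in> I \<Longrightarrow> 0 \<le> s a j"
  shows "(1 - s i j) * measure_pmf.expectation (independent_sample I p)
      (\<lambda>R. of_bool (overflow s i j (insert i R))) \<le> (\<Sum>a\<in>I. s a j * p a)"
proof -
  have "(1 - s i j) * of_bool (overflow s i j (insert i R)) \<le> (\<Sum>a\<in>I. s a j * of_bool (a \<in> R))"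
    if R: "R \<subseteq> I" for R
  proof (cases "overflow s i j (insert i R)")
    case True
    have fin: "finite R" "i \<notin> R"
      using R assms finite_subset by blast+
    then have "1 - s i j \<le> (\<Sum>a\<in>{a \<in> R. s i j \<le> s a j}. s a j)"
      using True by (simp add: overflow_insert_iff)
    also have "\<dots> = (\<Sum>a\<in>{a \<in> R. s i j \<le> s a j}. s a j * of_bool (a \<in> R))"
      by (intro sum.cong) auto
    also have "\<dots> \<le> (\<Sum>a\<in>I. s a j * of_bool (a \<in> R))"
      using R assms by (intro sum_mono2) auto
    finally show ?thesis
      using True by simp
  qed (use assms in \<open>auto intro!: sum_nonneg\<close>)
  then have "measure_pmf.expectation (independent_sample I p)
      (\<lambda>R. (1 - s i j) * of_bool (overflow s i j (insert i R)))
      \<le> measure_pmf.expectation (independent_sample I p) (\<lambda>R. \<Sum>a\<in>I. s a j * of_bool (a \<in> R))"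
    by (rule expectation_independent_sample_mono[OF assms(1)])
  also have "\<dots> = (\<Sum>a\<in>I. s a j * p a)"
    by (rule expectation_weighted_count[where p = p, OF assms(1,2) order.refl])
  finally show ?thesis by simp
qed

text \<open>The other items must exceed \<open>1 - s i j\<close>, which is at least 1/2. If none of
  them is big, one item of size at most 1/2 is not enough, so two are needed. The union bound over
  pairs is halved because the pairs are ordered.\<close>

lemma expectation_overflow_le_pairs:
  assumes "finite I" and "\<And>a. a \<in> I \<Longrightarrow> p a \<in> {0..1}" and "i \<notin> I" and "s i j \<le> 1 / 2"
  shows "measure_pmf.expectation (independent_sample I p)
      (\<lambda>R. of_bool (overflow s i j (insert i R)))
    \<le> (\<Sum>a\<in>big_items I s j. p a) + (\<Sum>a | a \<in> I \<and> s i j \<le> s a j \<and> s a j \<le> 1 / 2. p a)\<^sup>2 / 2"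
proof -
  let ?B = "big_items I s j"
  define M where "M = {a \<in> I. s i j \<le> s a j \<and> s a j \<le> 1 / 2}"
  define pairs where "pairs R = (\<Sum>a\<in>M. \<Sum>b\<in>M - {a}. of_bool (a \<in> R \<and> b \<in> R) :: real)" for R
  have finB: "finite ?B" and BI: "?B \<subseteq> I" and finM: "finite M" and MI: "M \<subseteq> I"
    using assms(1) by (auto simp: big_items_def M_def)
  have pairs_nonneg: "0 \<le> pairs R" for R
    unfolding pairs_def by (intro sum_nonneg) auto
  have "of_bool (overflow s i j (insert i R)) \<le> (\<Sum>a\<in>?B. 1 * of_bool (a \<in> R)) + pairs R / 2"
    if R: "R \<subseteq> I" for R
  proof (cases "overflow s i j (insert i R)")
    case True
    have fin: "finite R" "i \<notin> R"
      using R assms finite_subset by blast+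
    then have gt: "(\<Sum>a\<in>{a \<in> R. s i j \<le> s a j}. s a j) > 1 - s i j"
      using True by (simp add: overflow_insert_iff)
    show ?thesis
    proof (cases "R \<inter> ?B = {}")
      case False
      then obtain a where "a \<in> R" "a \<in> ?B" by blast
      then have "(1::real) \<le> (\<Sum>a\<in>?B. of_bool (a \<in> R))"
        using finB member_le_sum[of a ?B "\<lambda>a. of_bool (a \<in> R) :: real"] by simp
      then show ?thesis
        using pairs_nonneg[of R] by (simp add: of_bool_def)
    next
      case no_big: True
      then have eq: "{a \<in> R. s i j \<le> s a j} = R \<inter> M"
        using R by (auto simp: M_def big_items_def not_less)
      obtain a where a: "a \<in> R \<inter> M"
      proof (cases "R \<inter> M = {}")
        case True
        then show ?thesis
          using gt assms(4) eq by simp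
      qed (use that in blast)
      \<comment> \<open>If \<open>a\<close> were the only contributor, its size would have to exceed
        \<open>1 - s i j \<ge> 1 / 2\<close>, but items of \<open>M\<close> have size at most
        1/2.\<close>
      obtain b where b: "b \<in> R \<inter> M" "b \<noteq> a"
      proof (cases "R \<inter> M = {a}")
        case True
        then have "s a j > 1 - s i j" "s a j \<le> 1 / 2"
          using gt a unfolding eq by (auto simp: M_def)
        then show ?thesis
          using assms(4) by simp
      qed (use that a in blast)
      have inner: "1 \<le> (\<Sum>d\<in>M - {c}. of_bool (c \<in> R \<and> d \<in> R) :: real)"
        if "c \<in> R" "d \<in> R \<inter> M" "d \<noteq> c" for c d
        using that finM
          member_le_sum[of d "M - {c}" "\<lambda>d. of_bool (c \<in> R \<and> d \<in> R) :: real"] by simp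
      \<comment> \<open>The ordered pairs \<open>(a, b)\<close> and \<open>(b, a)\<close> contribute
        1 each.\<close>
      have "2 \<le> (\<Sum>c\<in>{a, b}. \<Sum>d\<in>M - {c}. of_bool (c \<in> R \<and> d \<in> R) :: real)"
        using inner[of a b] inner[of b a] a b by simp
      also have "\<dots> \<le> pairs R"
        unfolding pairs_def using a b finM by (intro sum_mono2) (auto intro: sum_nonneg)
      finally have "1 \<le> pairs R / 2" by simp
      moreover have "0 \<le> (\<Sum>a\<in>?B. 1 * of_bool (a \<in> R) :: real)"
        by (intro sum_nonneg) auto
      ultimately show ?thesis
        by (simp only: True of_bool_eq)
    qed
  qed (use pairs_nonneg[of R] in \<open>simp add: sum_nonneg\<close>)
  then have "measure_pmf.expectation (independent_sample I p)
      (\<lambda>R. of_bool (overflow s i j (insert i R)))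
      \<le> measure_pmf.expectation (independent_sample I p)
          (\<lambda>R. (\<Sum>a\<in>?B. 1 * of_bool (a \<in> R)) + pairs R / 2)"
    by (rule expectation_independent_sample_mono[OF assms(1)])
  also have "\<dots> = (\<Sum>a\<in>?B. 1 * p a) +
      measure_pmf.expectation (independent_sample I p) pairs / 2"
    using expectation_weighted_count[where p = p, OF assms(1,2) BI, of "\<lambda>_. 1"] assms(1)
    by (subst Bochner_Integration.integral_add) auto
  also have "\<dots> \<le> (\<Sum>a\<in>?B. p a) + (\<Sum>a\<in>M. p a)\<^sup>2 / 2"
    using expectation_ordered_pairs_le[where p = p, OF assms(1,2) MI] unfolding pairs_def by simp
  finally show ?thesis
    unfolding M_def .
qed

text \<open>The cube root balances two estimates of the excess over \<open>1 / \<beta>\<close>: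
  relative to \<open>1 / \<beta>\<close>, Markov costs \<open>2 * \<sigma>\<close> and the pair
  bound costs \<open>1 / (2 * \<sigma>\<^sup>2 * \<beta>)\<close>. Both equal \<open>t\<close> when
  \<open>2 * \<sigma> = t\<close>, since \<open>t ^ 3 = 2 / \<beta>\<close>.\<close>

lemma expectation_overflow_le:
  fixes \<beta> :: real
  assumes "finite I" and "i \<notin> I" and "1 \<le> \<beta>"
    and x: "\<And>a. a \<in> I \<Longrightarrow> x a \<in> {0..1}" and s: "\<And>a. a \<in> I \<Longrightarrow> 0 \<le> s a j"
    and "0 < s i j" and "s i j \<le> 1"
    and size: "(\<Sum>a\<in>I. s a j * x a) \<le> 1" and big: "(\<Sum>a\<in>big_items I s j. x a) \<le> 1"
  shows "measure_pmf.expectation (independent_sample I (\<lambda>a. x a / \<beta>))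
      (\<lambda>R. of_bool (overflow s i j (insert i R)))
    \<le> 1 / \<beta> * (1 + (2 / \<beta>) powr (1 / 3))"
    (is "?E \<le> _")
proof -
  define \<sigma> where "\<sigma> = s i j"
  define t where "t = (2 / \<beta>) powr (1 / 3)"
  have t0: "0 < t"
    using assms(3) by (simp add: t_def)
  have t3: "t ^ 3 = 2 / \<beta>"
    using assms(3) by (simp add: t_def powr_power)
  have p: "x a / \<beta> \<in> {0..1}" if "a \<in> I" for a
    using x[OF that] assms(3) by (auto simp: divide_le_eq)
  have big': "(\<Sum>a\<in>big_items I s j. x a / \<beta>) \<le> 1 / \<beta>"
    using big assms(3) by (simp add: sum_divide_distrib[symmetric] divide_right_mono)
  consider "1 / 2 < \<sigma>" | "\<sigma> \<le> 1 / 2" "2 * \<sigma> \<le> t" | "\<sigma> \<le> 1 / 2" "t \<le> 2 * \<sigma>"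
    by linarith
  then have "?E \<le> 1 / \<beta> * (1 + t)"
  proof cases
    case 1
    then have "?E \<le> 1 / \<beta>"
      using expectation_overflow_le_big[where p = "\<lambda>a. x a / \<beta>",
          OF assms(1) p assms(2), of s j] big' assms(7)
      unfolding \<sigma>_def by linarith
    also have "\<dots> \<le> 1 / \<beta> * (1 + t)"
      using t0 assms(3) by (simp add: field_simps)
    finally show ?thesis .
  next
    case 2
    have "(1 - \<sigma>) * ?E \<le> (\<Sum>a\<in>I. s a j * (x a / \<beta>))"
      unfolding \<sigma>_def
      by (rule expectation_overflow_le_Markov[where p = "\<lambda>a. x a / \<beta>" and s = s and j = j,
            OF assms(1) p assms(2) s])
    also have "\<dots> = (\<Sum>a\<in>I. s a j * x a) / \<beta>"
      by (simp add: sum_divide_distrib)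
    also have "\<dots> \<le> 1 / \<beta>"
      using size assms(3) by (simp add: divide_right_mono)
    \<comment> \<open>The factor \<open>1 - \<sigma>\<close> is introduced here to cancel against
      the left side; the product exceeds 1 by exactly \<open>\<sigma> * (1 - 2 * \<sigma>)\<close>,
      which is nonnegative for \<open>\<sigma> \<le> 1 / 2\<close>.\<close>
    also have "\<dots> \<le> 1 / \<beta> * ((1 - \<sigma>) * (1 + 2 * \<sigma>))"
    proof -
      have "0 \<le> \<sigma> * (1 - 2 * \<sigma>)"
        using 2 assms(6) by (simp add: \<sigma>_def)
      then have "1 \<le> (1 - \<sigma>) * (1 + 2 * \<sigma>)"
        by (simp add: algebra_simps)
      from mult_left_mono[OF this, of "1 / \<beta>"] show ?thesis
        using assms(3) by simp
    qed
    also have "\<dots> = (1 - \<sigma>) * (1 / \<beta> * (1 + 2 * \<sigma>))"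
      by simp
    finally have "?E \<le> 1 / \<beta> * (1 + 2 * \<sigma>)"
      using 2 by (subst (asm) mult_le_cancel_left_pos) auto
    also have "\<dots> \<le> 1 / \<beta> * (1 + t)"
      using 2 assms(3) by (intro mult_left_mono) auto
    finally show ?thesis .
  next
    case 3
    have \<sigma>0: "0 < \<sigma>"
      using assms(6) by (simp add: \<sigma>_def)
    define M where "M = {a \<in> I. \<sigma> \<le> s a j \<and> s a j \<le> 1 / 2}"
    \<comment> \<open>Every item of \<open>M\<close> has size at least \<open>\<sigma>\<close>, so
      the size constraint limits the LP weight of \<open>M\<close>.\<close>
    have "\<sigma> * (\<Sum>a\<in>M. x a) \<le> (\<Sum>a\<in>M. s a j * x a)"
      unfolding sum_distrib_left using x by (intro sum_mono mult_right_mono) (auto simp: M_def)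
    also have "\<dots> \<le> (\<Sum>a\<in>I. s a j * x a)"
      using assms(1) x s by (intro sum_mono2) (auto simp: M_def)
    finally have "(\<Sum>a\<in>M. x a) \<le> 1 / \<sigma>"
      using size \<sigma>0 by (simp add: field_simps)
    then have "(\<Sum>a\<in>M. x a / \<beta>) \<le> 1 / \<sigma> / \<beta>"
      using assms(3) by (simp only: sum_divide_distrib[symmetric] divide_right_mono)
    moreover have "0 \<le> (\<Sum>a\<in>M. x a / \<beta>)"
      using p by (intro sum_nonneg) (auto simp: M_def)
    ultimately have "(\<Sum>a\<in>M. x a / \<beta>)\<^sup>2 \<le> (1 / \<sigma> / \<beta>)\<^sup>2"
      by (rule power_mono)
    \<comment> \<open>After clearing denominators the claim is
      \<open>2 / \<beta> \<le> 4 * t * \<sigma>\<^sup>2\<close>, which follows from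
      \<open>t ^ 3 = 2 / \<beta>\<close> and \<open>t \<le> 2 * \<sigma>\<close>.\<close>
    moreover have "(1 / \<sigma> / \<beta>)\<^sup>2 / 2 \<le> t / \<beta>"
    proof -
      have "t\<^sup>2 \<le> (2 * \<sigma>)\<^sup>2"
        using 3 t0 by (intro power_mono) auto
      then have "t * t\<^sup>2 \<le> t * (4 * \<sigma>\<^sup>2)"
        using t0 by (intro mult_left_mono) auto
      then have "2 / \<beta> \<le> t * (4 * \<sigma>\<^sup>2)"
        using t3 by (simp add: power3_eq_cube power2_eq_square)
      then show ?thesis
        using \<sigma>0 assms(3) by (simp add: field_simps power2_eq_square)
    qed
    moreover have "?E \<le> (\<Sum>a\<in>big_items I s j. x a / \<beta>) + (\<Sum>a\<in>M. x a / \<beta>)\<^sup>2 / 2"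
      unfolding M_def \<sigma>_def
      by (rule expectation_overflow_le_pairs[where p = "\<lambda>a. x a / \<beta>", OF assms(1) p assms(2)])
        (use 3 \<sigma>_def in auto)
    ultimately have "?E \<le> 1 / \<beta> + t / \<beta>"
      using big' by linarith
    then show ?thesis
      by (simp add: add_divide_distrib)
  qed
  then show ?thesis
    by (simp add: t_def)
qed

section \<open>Survival of a sampled item\<close>

lemma prob_eq_expectation_of_bool:
  "\<P>(R in measure_pmf M. P R) = measure_pmf.expectation M (\<lambda>R. of_bool (P R))"
proof -
  have "(\<lambda>R. of_bool (P R)) = (indicator {R. P R} :: _ \<Rightarrow> real)"
    by (auto simp: indicator_def)
  then show ?thesis by simp
qed

text \<open>Given \<open>i \<in> R\<close>, the other coins keep their joint law. The conditional
  probability thus becomes an expectation over an independent sample of \<open>I - {i}\<close>,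
  where Harris' inequality is available.\<close>

lemma cond_prob_independent_sample_mem:
  assumes "finite I" and "i \<in> I" and "0 < p i" and "p i \<le> 1"
  shows "\<P>(R in measure_pmf (independent_sample I p). P R \<bar> i \<in> R) =
    measure_pmf.expectation (independent_sample (I - {i}) p) (\<lambda>R. of_bool (P (insert i R)))"
proof -
  have p: "p i \<in> {0..1}"
    using assms by simp
  have "measure_pmf.expectation (independent_sample I p) (\<lambda>R. of_bool (P R \<and> i \<in> R)) =
      p i * measure_pmf.expectation (independent_sample (I - {i}) p)
        (\<lambda>R. of_bool (P (insert i R)))"
    using expectation_independent_sample_notin[of "I - {i}" i p P] assms(1)
    by (subst expectation_independent_sample_remove[where p = p, OF assms(1,2) p])
      (simp add: conj_commute)
  then show ?thesis
    using assms(3) expectation_independent_sample_mem[where p = p, OF assms(1,2) p]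
    by (simp add: cond_prob_def prob_eq_expectation_of_bool[simplified])
qed

text \<open>The base is truncated at 0 because it is negative when \<open>\<alpha> * real k\<close>
  is close to 1; an even power of it could then even exceed 1. Where the base is nonnegative, the
  truncation changes nothing.\<close>

theorem theorem3:
  fixes I :: "'i set" and J :: "'j set" and k :: nat and \<alpha> :: real
    and w x :: "'i \<Rightarrow> real" and s :: "'i \<Rightarrow> 'j \<Rightarrow> real" and c :: "'j \<Rightarrow> real" and i :: 'i
  assumes "kcs_pip k I J w s c"
    and "\<forall>j\<in>J. c j = 1"
    and "\<forall>i\<in>I. \<forall>j\<in>J. s i j \<le> 1"
    and "\<alpha> > 0" and "\<alpha> * real k \<ge> 1"
    and "strong_lp_optimal I J w s x"
    and "i \<in> I" and "x i > 0"
  shows "\<P>(R in measure_pmf (independent_sample I (\<lambda>i. x i / (\<alpha> * real k))).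
            i \<in> altered J s R \<bar> i \<in> R)
         \<ge> (max 0 (1 - 1 / (\<alpha> * real k) * (1 + (2 / (\<alpha> * real k)) powr (1 / 3)))) ^ k"
proof -
  define \<beta> where "\<beta> = \<alpha> * real k"
  define p where "p = (\<lambda>i. x i / \<beta>)"
  define I' where "I' = I - {i}"
  define K where "K = {j \<in> J. 0 < s i j}"
  define E :: "('i set \<Rightarrow> real) \<Rightarrow> real"
    where "E = measure_pmf.expectation (independent_sample I' p)"
  define q where "q = 1 / \<beta> * (1 + (2 / \<beta>) powr (1 / 3))"
  have fin: "finite I" "finite J" and s0: "\<And>a j. a \<in> I \<Longrightarrow> j \<in> J \<Longrightarrow> 0 \<le> s a j"
    and col: "card {j \<in> J. s i j \<noteq> 0} \<le> k"
    using assms(1,7) by (auto simp: kcs_pip_def)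
  have feas: "strong_lp_feasible I J s x"
    using assms(6) by (simp add: strong_lp_optimal_def)
  then have x01: "x a \<in> {0..1}" if "a \<in> I" for a
    using that by (auto simp: strong_lp_feasible_def)
  have \<beta>: "1 \<le> \<beta>"
    using assms(5) by (simp add: \<beta>_def)
  have p01: "p a \<in> {0..1}" if "a \<in> I" for a
    using x01[OF that] \<beta> by (auto simp: p_def divide_le_eq)
  have "K = {j \<in> J. s i j \<noteq> 0}"
    using s0[OF assms(7)] by (force simp: K_def)
  then have K: "finite K" "card K \<le> k"
    using fin col by auto
  have finI': "finite I'" and iI': "i \<notin> I'" and I'I: "I' \<subseteq> I"
    using fin by (auto simp: I'_def)
  have overflow: "E (\<lambda>R. of_bool (overflow s i j (insert i R))) \<le> q" if "j \<in> K" for j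
    unfolding E_def p_def q_def
  proof (rule expectation_overflow_le[OF finI' iI' \<beta>])
    have j: "j \<in> J" "0 < s i j"
      using that by (auto simp: K_def)
    show "0 < s i j" "s i j \<le> 1"
      using j assms(3,7) by auto
    show "x a \<in> {0..1}" "0 \<le> s a j" if "a \<in> I'" for a
      using that I'I x01 s0 j by blast+
    \<comment> \<open>Removing the nonnegative term of \<open>i\<close> preserves both LP
      constraints.\<close>
    have "(\<Sum>a\<in>I'. s a j * x a) \<le> (\<Sum>a\<in>I. s a j * x a)"
      using fin I'I s0 j x01 by (intro sum_mono2) auto
    then show "(\<Sum>a\<in>I'. s a j * x a) \<le> 1"
      using feas j by (force simp: strong_lp_feasible_def)
    have "(\<Sum>a\<in>big_items I' s j. x a) \<le> (\<Sum>a\<in>big_items I s j. x a)"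
      using fin I'I x01 by (intro sum_mono2) (auto simp: big_items_def)
    then show "(\<Sum>a\<in>big_items I' s j. x a) \<le> 1"
      using feas j by (force simp: strong_lp_feasible_def)
  qed
  have single: "max 0 (1 - q) \<le> E (\<lambda>R. of_bool (\<not> overflow s i j (insert i R)))" if "j \<in> K" for j
  proof -
    have "E (\<lambda>R. of_bool (\<not> overflow s i j (insert i R))) =
        1 - E (\<lambda>R. of_bool (overflow s i j (insert i R)))"
      unfolding E_def using finI' by (simp add: of_bool_not_iff)
    moreover have "0 \<le> E (\<lambda>R. of_bool (\<not> overflow s i j (insert i R)))"
      unfolding E_def by (intro Bochner_Integration.integral_nonneg) auto
    ultimately show ?thesis
      using overflow[OF that] by simp
  qed
  have "0 \<le> q"
    using \<beta> by (simp add: q_def)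
  \<comment> \<open>Item \<open>i\<close> may occur in fewer than \<open>k\<close> constraints;
    since the base lies between 0 and 1, the larger exponent gives the smaller value.\<close>
  then have "max 0 (1 - q) ^ k \<le> max 0 (1 - q) ^ card K"
    using K by (intro power_decreasing) auto
  also have "\<dots> = (\<Prod>j\<in>K. max 0 (1 - q))"
    by simp
  also have "\<dots> \<le> (\<Prod>j\<in>K. E (\<lambda>R. of_bool (\<not> overflow s i j (insert i R))))"
    using single by (intro prod_mono) auto
  also have "\<dots> \<le> E (\<lambda>R. \<Prod>j\<in>K. of_bool (\<not> overflow s i j (insert i R)))"
    unfolding E_def
  \<comment> \<open>Enlarging the sample only adds nonnegative sizes, so each non-overflow indicator
    is decreasing.\<close>
  proof (rule Harris_inequality_prod_antimono[where p = p, OF finI' _ K(1)])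
    fix j R R' assume "j \<in> K" "R \<subseteq> R'" "R' \<subseteq> I'"
    then have "overflow s i j (insert i R')" if "overflow s i j (insert i R)"
      using that s0 I'I assms(7) finI'
      by (intro overflow_mono[OF that]) (auto simp: K_def dest: finite_subset)
    then show "of_bool (\<not> overflow s i j (insert i R')) \<le>
        (of_bool (\<not> overflow s i j (insert i R)) :: real)"
      by auto
  qed (use p01 I'I in auto)
  also have "\<dots> = E (\<lambda>R. of_bool (i \<in> altered J s (insert i R)))"
  proof -
    \<comment> \<open>A product of indicators is the indicator of the conjunction, which here says
      that \<open>i\<close> survives the alteration.\<close>
    have "(\<Prod>j\<in>K. of_bool (P j)) = (of_bool (\<forall>j\<in>K. P j) :: real)" for P
      using K(1) by (induction K rule: finite_induct) auto
    then show ?thesis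
      by (simp add: altered_def K_def Ball_def imp_conjL)
  qed
  also have "\<dots> = \<P>(R in measure_pmf (independent_sample I p). i \<in> altered J s R \<bar> i \<in> R)"
    using cond_prob_independent_sample_mem[of I i p "\<lambda>R. i \<in> altered J s R"]
      fin assms(7,8) \<beta> p01[OF assms(7)]
    by (simp add: E_def I'_def p_def)
  finally show ?thesis
    by (simp add: p_def q_def \<beta>_def)
qed

end
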